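(* Let $\lambda$ be a real number, let $\Lambda=\{\lambda_n\}_{n\ge0}$ be the constant sequence $\lambda_n=\lambda$ for all $n\ge 0$, and let $n\ge 0$ and $m\ge 1$ be integers. Then $(V_n[\Lambda])^m$ is the vertically-recurrent matrix whose associated sequence is $$\lambda^m\left(\frac{\lambda^m-1}{\lambda-1}\right)^{i},\qquad i\ge 0,$$ that is, $(V_n[\Lambda])^m=V_n[\Lambda^{(m)}]$ with $\Lambda^{(m)}=\bigl\{\lambda^m\bigl(\tfrac{\lambda^m-1}{\lambda-1}\bigr)^{i}\bigr\}_{i\ge0}$. Here $\frac{\lambda^m-1}{\lambda-1}$ is understood as $1+\lambda+\cdots+\lambda^{m-1}$ (so it equals $m$ when $\lambda=1$), and $x^0=1$ for all $x$.
   Context: Rows and columns of matrices are indexed from $0$. Given a sequence $\Lambda=\{\lambda_n\}_{n\ge0}$ of real numbers (with no normalization of $\lambda_0$ required), define numbers $a_{i,j}$ ($i,j\ge 0$) by $a_{i,0}=\lambda_i$ for $i\ge 0$, $a_{i,j}=0$ for $i<j$, and $$a_{i,j}=\sum_{l=j-1}^{i-1}\lambda_{i-1-l}\,a_{l,j-1}\qquad (i\ge j\ge 1).$$ The vertically-recurrent matrix with associated sequence $\Lambda$, of order $(n+1)\times(n+1)$, is $V_n[\Lambda]=[a_{i,j}]_{0\le i,j\le n}$. *)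

theory Defs
  imports "Jordan_Normal_Form.Matrix"
begin

text \<open>In the recurrence the second index is shifted: for \<open>i \<ge> j + 1\<close>, the sum over
  \<open>l = j, \<dots>, i - 1\<close> defines the entry in row \<open>i\<close> and column \<open>j + 1\<close>.\<close>

fun vr_entry :: "(nat \<Rightarrow> real) \<Rightarrow> nat \<Rightarrow> nat \<Rightarrow> real" where
  "vr_entry \<Lambda> i 0 = \<Lambda> i"
| "vr_entry \<Lambda> i (Suc j) =
     (if i < Suc j then 0 else (\<Sum>l = j..i - 1. \<Lambda> (i - 1 - l) * vr_entry \<Lambda> l j))"

definition vr_mat :: "nat \<Rightarrow> (nat \<Rightarrow> real) \<Rightarrow> real mat" where
  "vr_mat n \<Lambda> = mat (n + 1) (n + 1) (\<lambda>(i, j). vr_entry \<Lambda> i j)"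

end

theory Submission
  imports Defs
begin

text \<open>The matrix of a geometric sequence \<open>c * s ^ i\<close> is the Riordan array attached to
  \<open>F(x) = c * x / (1 - s * x)\<close>: column \<open>j\<close> has generating function \<open>F(x) ^ (j + 1) / x\<close>. Matrix
  multiplication corresponds to composition of these Moebius transformations, so the parameters of a
  product are \<open>c * d\<close> and \<open>s + c * t\<close>; powers of \<open>(lam, 1)\<close> give \<open>lam ^ m\<close> and
  \<open>1 + lam + \<dots> + lam ^ (m - 1)\<close>.\<close>

lemma vr_entry_geometric:
  "vr_entry (\<lambda>i. c * s ^ i) i j = c ^ (j + 1) * s ^ (i - j) * real (i choose j)"
proof (induction j arbitrary: i)
  case 0
  show ?case by simp
next
  case (Suc j)
  show ?case
  proof (cases "i < Suc j")
    case True
    then show ?thesis by (simp add: binomial_eq_0)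
  next
    case False
    then obtain k where i: "i = Suc k" and "j \<le> k"
      by (cases i) auto
    have "vr_entry (\<lambda>i. c * s ^ i) i (Suc j)
        = (\<Sum>l = j..k. c * s ^ (k - l) * (c ^ (j + 1) * s ^ (l - j) * real (l choose j)))"
      using \<open>j \<le> k\<close> by (simp add: i Suc.IH)
    \<comment> \<open>The exponents \<open>k - l\<close> and \<open>l - j\<close> add up to
      \<open>k - j\<close>, so the powers of \<open>s\<close> no longer depend on \<open>l\<close>
      and only a hockey-stick sum remains.\<close>
    also have "\<dots> = (\<Sum>l = j..k. c ^ (j + 2) * s ^ (k - j) * real (l choose j))"
    proof (rule sum.cong)
      fix l assume "l \<in> {j..k}"
      then have "s ^ (k - j) = s ^ (k - l) * s ^ (l - j)"
        by (simp flip: power_add)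
      then show "c * s ^ (k - l) * (c ^ (j + 1) * s ^ (l - j) * real (l choose j))
          = c ^ (j + 2) * s ^ (k - j) * real (l choose j)"
        by simp
    qed simp
    also have "\<dots> = c ^ (j + 2) * s ^ (k - j) * real (\<Sum>l = j..k. l choose j)"
      by (simp add: sum_distrib_left)
    \<comment> \<open>The added terms with \<open>l < j\<close> vanish.\<close>
    also have "(\<Sum>l = j..k. l choose j) = (\<Sum>l \<le> k. l choose j)"
      by (rule sum.mono_neutral_left) (auto simp: binomial_eq_0)
    also have "\<dots> = i choose Suc j"
      by (simp add: i sum_choose_upper)
    finally show ?thesis by (simp add: i)
  qed
qed

text \<open>Trinomial revision turns the two binomials into \<open>n choose k\<close> times
  \<open>(n - k) choose (j - k)\<close>; shifting \<open>j\<close> by \<open>k\<close> leaves the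
  binomial theorem.\<close>

lemma sum_choose_mult_choose:
  fixes x y :: "'a::comm_semiring_1"
  assumes "k \<le> n"
  shows "(\<Sum>j = k..n. of_nat (n choose j) * of_nat (j choose k) * x ^ (j - k) * y ^ (n - j))
       = of_nat (n choose k) * (x + y) ^ (n - k)"
proof -
  have "(\<Sum>j = k..n. of_nat (n choose j) * of_nat (j choose k) * x ^ (j - k) * y ^ (n - j))
      = (\<Sum>j = k..n. of_nat (n choose k) * (of_nat ((n - k) choose (j - k)) * x ^ (j - k) * y ^ (n - j)))"
    by (rule sum.cong) (simp_all add: choose_mult flip: of_nat_mult mult.assoc)
  also have "\<dots> = of_nat (n choose k)
      * (\<Sum>j \<le> n - k. of_nat ((n - k) choose j) * x ^ j * y ^ (n - k - j))"
    unfolding sum_distrib_left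
    by (rule sum.reindex_bij_witness[of _ "\<lambda>j. j + k" "\<lambda>j. j - k"]) (use assms in auto)
  also have "\<dots> = of_nat (n choose k) * (x + y) ^ (n - k)"
    by (simp add: binomial_ring)
  finally show ?thesis .
qed

text \<open>Cutting the product off at \<open>n\<close> loses nothing: by triangularity only
  \<open>k \<le> j \<le> i\<close> contributes, and \<open>i \<le> n\<close>.\<close>

lemma sum_vr_entry_geometric_mult:
  assumes "i \<le> n"
  shows "(\<Sum>j \<le> n. vr_entry (\<lambda>i. c * s ^ i) i j * vr_entry (\<lambda>i. d * t ^ i) j k)
       = vr_entry (\<lambda>i. c * d * (s + c * t) ^ i) i k"
proof -
  have "(\<Sum>j \<le> n. vr_entry (\<lambda>i. c * s ^ i) i j * vr_entry (\<lambda>i. d * t ^ i) j k)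
      = (\<Sum>j = k..i. vr_entry (\<lambda>i. c * s ^ i) i j * vr_entry (\<lambda>i. d * t ^ i) j k)"
    by (rule sum.mono_neutral_right)
      (use assms in \<open>auto simp: vr_entry_geometric binomial_eq_0 not_le\<close>)
  also have "\<dots> = (\<Sum>j = k..i. (c * d) ^ (k + 1)
      * (real (i choose j) * real (j choose k) * (c * t) ^ (j - k) * s ^ (i - j)))"
  proof (rule sum.cong)
    fix j assume "j \<in> {k..i}"
    \<comment> \<open>The surplus \<open>c ^ (j - k)\<close> joins \<open>t ^ (j - k)\<close>, which
      is how \<open>c * t\<close> enters the new ratio.\<close>
    then have "c ^ (j + 1) = c ^ (k + 1) * c ^ (j - k)"
      by (simp flip: power_add)
    then show "vr_entry (\<lambda>i. c * s ^ i) i j * vr_entry (\<lambda>i. d * t ^ i) j k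
        = (c * d) ^ (k + 1)
          * (real (i choose j) * real (j choose k) * (c * t) ^ (j - k) * s ^ (i - j))"
      unfolding vr_entry_geometric power_mult_distrib by (simp only: mult_ac)
  qed simp
  also have "\<dots> = vr_entry (\<lambda>i. c * d * (s + c * t) ^ i) i k"
  proof (cases "k \<le> i")
    case True
    then show ?thesis
      unfolding vr_entry_geometric sum_distrib_left[symmetric]
      by (simp add: sum_choose_mult_choose add.commute)
  next
    case False
    then show ?thesis by (simp add: vr_entry_geometric binomial_eq_0)
  qed
  finally show ?thesis .
qed

lemma vr_mat_geometric_mult:
  "vr_mat n (\<lambda>i. c * s ^ i) * vr_mat n (\<lambda>i. d * t ^ i) = vr_mat n (\<lambda>i. c * d * (s + c * t) ^ i)"
  by (rule eq_matI)
    (simp_all add: vr_mat_def scalar_prod_def atLeast0LessThan lessThan_Suc_atMost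
      sum_vr_entry_geometric_mult del: sum.atMost_Suc sum.lessThan_Suc)

lemma vr_mat_zero_power: "vr_mat n (\<lambda>i. 0 ^ i) = 1\<^sub>m (n + 1)"
proof -
  \<comment> \<open>For \<open>i < j\<close> truncated subtraction gives \<open>0 ^ 0 = 1\<close>,
    so there the binomial coefficient makes the entry vanish.\<close>
  have "vr_entry (\<lambda>i. 0 ^ i) i j = (if i = j then 1 else 0)" for i j
    using vr_entry_geometric[of 1 0 i j] by (simp add: power_0_left binomial_eq_0)
  then show ?thesis by (intro eq_matI) (simp_all add: vr_mat_def)
qed

theorem proposition3p1:
  fixes lam :: real and n m :: nat
  assumes "m \<ge> 1"
  shows "vr_mat n (\<lambda>_. lam) ^\<^sub>m m = vr_mat n (\<lambda>i. lam ^ m * (\<Sum>k<m. lam ^ k) ^ i)"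
proof (induction m)
  case 0
  \<comment> \<open>The zeroth power is the identity of size \<open>dim_row\<close>; on the right
    the empty sum leaves the sequence \<open>0 ^ i\<close>.\<close>
  have "dim_row (vr_mat n (\<lambda>_. lam)) = n + 1" by (simp add: vr_mat_def)
  then show ?case by (simp add: vr_mat_zero_power)
next
  case (Suc m)
  \<comment> \<open>The constant sequence is geometric with ratio 1, so the new ratio is the old sum
    plus \<open>lam ^ m\<close>.\<close>
  then show ?case
    using vr_mat_geometric_mult[of n "lam ^ m" "\<Sum>k<m. lam ^ k" lam 1] by (simp add: mult.commute)
qed

end
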